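(* Let $f_1:\mathbb{R}^{n_1}\to\mathbb{R}$ be closed proper convex, $f_2:\mathbb{R}^{n_2}\to\mathbb{R}$ closed, proper and $\sigma$-strongly convex with $\sigma>0$, $A_1\in\mathbb{R}^{l\times n_1}$, $A_2\in\mathbb{R}^{l\times n_2}$, $b\in\mathbb{R}^l$. Write $x=(x_1,x_2)$, $Ax=A_1x_1+A_2x_2$, $\Omega=\{x:Ax=b\}$. Let $\gamma\in(0,(1+\sqrt5)/2]$ and let $\beta^k>0$ satisfy, for all indices $k$ for which the terms are defined, $$\beta^k\left(\beta^k+\frac{\sigma}{\sigma_{\max}(A_2^TA_2)}\right)\ge(\beta^{k+1})^2,\qquad \frac{(\beta^k)^3\sigma_{\max}(A_2^TA_2)}{\beta^k\sigma_{\max}(A_2^TA_2)+\sigma}\le(\beta^{k-1})^2,\qquad \beta^{k+1}\ge\beta^k.$$ Let $\{(x_1^k,x_2^k,\lambda^k)\}$ be generated by ADMM $$\begin{cases}x_1^{k+1}\in\arg\min_{x_1}L_{\beta^k}(x_1,x_2^k,\lambda^k),\\ x_2^{k+1}\in\arg\min_{x_2}L_{\beta^k}(x_1^{k+1},x_2,\lambda^k),\\ \lambda^{k+1}=\lambda^k-\gamma\beta^k(A_1x_1^{k+1}+A_2x_2^{k+1}-b),\end{cases}$$ put $v^k=(x_2^k,\lambda^k)$ and $\widetilde v^k=(\widetilde x_2^k,\widetilde\lambda^k)$ with $\widetilde x_2^k=x_2^{k+1}$, $\widetilde\lambda^k=\lambda^k-\beta^k(A_1x_1^{k+1}+A_2x_2^k-b)$,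 and $$H^k=\begin{pmatrix}\beta^kA_2^TA_2&0\\0&\frac1{\gamma\beta^k}I_l\end{pmatrix},\quad G^k=\begin{pmatrix}(1-\gamma)\beta^kA_2^TA_2&-(1-\gamma)A_2^T\\-(1-\gamma)A_2&\frac{2-\gamma}{\beta^k}I_l\end{pmatrix},\quad H_0^k=\begin{pmatrix}(\beta^k)^2A_2^TA_2&0\\0&\frac1\gamma I_l\end{pmatrix}.$$ Then the convergence condition (CC3) holds with $r^k=\beta^k$, $R=I_{n_2}$, $z'=x_2'$, $z^k=x_2^{k+1}$, this $H_0^k$, and $\Theta^k=(1-\gamma)^2(\beta^{k-1})^2\|Ax^k-b\|^2$: that is, $r^k>0$, $H_0^k\succeq0$, $\Theta^k\ge0$, and for every $k\ge1$, every $x'=(x_1',x_2')\in\Omega$ and $\lambda\in\mathbb{R}^l$, with $v'=(x_2',\lambda)$, $$\begin{aligned}&\beta^k\left(\|v^{k+1}-v'\|^2_{H^k}+\sigma\|x_2^{k+1}-x_2'\|^2-\|v^k-v'\|^2_{H^k}+\|v^k-\widetilde v^k\|^2_{G^k}\right)\\ &\quad\ge\ \|v^{k+1}-v'\|^2_{H_0^{k+1}}-\|v^k-v'\|^2_{H_0^k}+\Theta^{k+1}-\Theta^k.\end{aligned}$$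
   Context: $\|y\|_D^2:=y^TDy$ for a symmetric matrix $D$, whether or not it is positive semidefinite; $\sigma_{\max}(\cdot)$ is the maximal eigenvalue (so $A_2\neq0$ is implicit in dividing by $\sigma_{\max}(A_2^TA_2)$). $f_2$ is $\sigma$-strongly convex if $f_2(y)\ge f_2(x)+\langle f_2'(x),y-x\rangle+\frac\sigma2\|y-x\|^2$ for all $x,y$ and all $f_2'(x)\in\partial f_2(x)$. The augmented Lagrangian is $L_\beta(x_1,x_2,\lambda)=f_1(x_1)+f_2(x_2)-\lambda^T(A_1x_1+A_2x_2-b)+\frac\beta2\|A_1x_1+A_2x_2-b\|^2$. Iterations are indexed from $k=0$ with given $x_2^0,\lambda^0$; $x^k=(x_1^k,x_2^k)$. The general form of condition (CC3) is: for $r^k>0$, $H_0^k\succeq0$, $\Theta^k\ge0$, $$r^k\left(\|v^{k+1}-v'\|^2_{H^k}+\sigma\|z^k-z'\|^2_R-\|v^k-v'\|^2_{H^k}+\|v^k-\widetilde v^k\|^2_{G^k}\right)\ge\|v^{k+1}-v'\|^2_{H_0^{k+1}}-\|v^k-v'\|^2_{H_0^k}+\Theta^{k+1}-\Theta^k.$$ The minimization subproblems are assumed solvable, so that the sequence is well defined. *)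

theory Defs
  imports "HOL-Analysis.Analysis"
begin

definition proper_fun :: "('a \<Rightarrow> ereal) \<Rightarrow> bool" where
  "proper_fun f \<longleftrightarrow> (\<forall>x. f x \<noteq> -\<infinity>) \<and> (\<exists>x. f x \<noteq> \<infinity>)"

text \<open>
  The objective functions are real-valued on the whole space, so closedness (of the epigraph) and
  properness are conventional parts of the hypothesis rather than restrictions.
\<close>

definition closed_proper :: "('a::euclidean_space \<Rightarrow> real) \<Rightarrow> bool" where
  "closed_proper f \<longleftrightarrow> closed (epigraph UNIV f) \<and> proper_fun (\<lambda>x. ereal (f x))"

definition closed_proper_convex :: "('a::euclidean_space \<Rightarrow> real) \<Rightarrow> bool" where
  "closed_proper_convex f \<longleftrightarrow> closed_proper f \<and> convex_on UNIV f"

definition subdifferential :: "('a::euclidean_space \<Rightarrow> real) \<Rightarrow> 'a \<Rightarrow> 'a set" where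
  "subdifferential f x = {g. \<forall>y. f y \<ge> f x + g \<bullet> (y - x)}"

text \<open>
  Convexity is part of the notion: the subgradient inequality alone would hold vacuously at points
  where the subdifferential is empty.
\<close>

definition strongly_convex :: "real \<Rightarrow> ('a::euclidean_space \<Rightarrow> real) \<Rightarrow> bool" where
  "strongly_convex \<sigma> f \<longleftrightarrow> convex_on UNIV f \<and>
     (\<forall>x y. \<forall>g\<in>subdifferential f x. f y \<ge> f x + g \<bullet> (y - x) + \<sigma> / 2 * (norm (y - x))\<^sup>2)"

definition max_eigenvalue :: "real^'n^'n \<Rightarrow> real" where
  "max_eigenvalue M = (GREATEST c. \<exists>u. u \<noteq> 0 \<and> M *v u = c *\<^sub>R u)"

text \<open>The matrix \<open>D\<close> need not be positive semidefinite, so this may be negative.\<close>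

definition sqnorm :: "real^'n^'n \<Rightarrow> real^'n \<Rightarrow> real" where
  "sqnorm D y = y \<bullet> (D *v y)"

definition pos_semidef :: "real^'n^'n \<Rightarrow> bool" where
  "pos_semidef D \<longleftrightarrow> transpose D = D \<and> (\<forall>y. 0 \<le> y \<bullet> (D *v y))"

text \<open>Stacked vectors and two-by-two block matrices are indexed by a sum type.\<close>

definition stack :: "real^'m \<Rightarrow> real^'l \<Rightarrow> real^('m + 'l)" where
  "stack x y = (\<chi> i. case i of Inl a \<Rightarrow> x $ a | Inr b \<Rightarrow> y $ b)"

definition block_matrix ::
  "real^'m^'m \<Rightarrow> real^'l^'m \<Rightarrow> real^'m^'l \<Rightarrow> real^'l^'l \<Rightarrow> real^('m + 'l)^('m + 'l)" where
  "block_matrix P Q S T = (\<chi> i j.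
     case i of
       Inl a \<Rightarrow> (case j of Inl c \<Rightarrow> P $ a $ c | Inr d \<Rightarrow> Q $ a $ d)
     | Inr b \<Rightarrow> (case j of Inl c \<Rightarrow> S $ b $ c | Inr d \<Rightarrow> T $ b $ d))"

definition aug_lagrangian ::
  "(real^'n1 \<Rightarrow> real) \<Rightarrow> (real^'n2 \<Rightarrow> real) \<Rightarrow> real^'n1^'l \<Rightarrow> real^'n2^'l \<Rightarrow> real^'l \<Rightarrow>
   real \<Rightarrow> real^'n1 \<Rightarrow> real^'n2 \<Rightarrow> real^'l \<Rightarrow> real" where
  "aug_lagrangian f1 f2 A1 A2 b \<beta> x1 x2 \<mu> =
     f1 x1 + f2 x2 - \<mu> \<bullet> (A1 *v x1 + A2 *v x2 - b)
       + \<beta> / 2 * (norm (A1 *v x1 + A2 *v x2 - b))\<^sup>2"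

definition admm_sequence ::
  "(real^'n1 \<Rightarrow> real) \<Rightarrow> (real^'n2 \<Rightarrow> real) \<Rightarrow> real^'n1^'l \<Rightarrow> real^'n2^'l \<Rightarrow> real^'l \<Rightarrow>
   real \<Rightarrow> (nat \<Rightarrow> real) \<Rightarrow> (nat \<Rightarrow> real^'n1) \<Rightarrow> (nat \<Rightarrow> real^'n2) \<Rightarrow> (nat \<Rightarrow> real^'l) \<Rightarrow> bool" where
  "admm_sequence f1 f2 A1 A2 b \<gamma> \<beta> x1 x2 lam \<longleftrightarrow>
     (\<forall>k. is_arg_min (\<lambda>u. aug_lagrangian f1 f2 A1 A2 b (\<beta> k) u (x2 k) (lam k))
            (\<lambda>_. True) (x1 (Suc k)) \<and>
          is_arg_min (\<lambda>w. aug_lagrangian f1 f2 A1 A2 b (\<beta> k) (x1 (Suc k)) w (lam k))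
            (\<lambda>_. True) (x2 (Suc k)) \<and>
          lam (Suc k) = lam k - (\<gamma> * \<beta> k) *\<^sub>R (A1 *v x1 (Suc k) + A2 *v x2 (Suc k) - b))"

definition H_mat :: "real^'n2^'l \<Rightarrow> real \<Rightarrow> real \<Rightarrow> real^('n2 + 'l)^('n2 + 'l)" where
  "H_mat A2 \<gamma> \<beta> = block_matrix (\<beta> *\<^sub>R (transpose A2 ** A2)) 0 0 ((1 / (\<gamma> * \<beta>)) *\<^sub>R mat 1)"

definition G_mat :: "real^'n2^'l \<Rightarrow> real \<Rightarrow> real \<Rightarrow> real^('n2 + 'l)^('n2 + 'l)" where
  "G_mat A2 \<gamma> \<beta> = block_matrix
     (((1 - \<gamma>) * \<beta>) *\<^sub>R (transpose A2 ** A2)) (- ((1 - \<gamma>) *\<^sub>R transpose A2))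
     (- ((1 - \<gamma>) *\<^sub>R A2)) (((2 - \<gamma>) / \<beta>) *\<^sub>R mat 1)"

definition H0_mat :: "real^'n2^'l \<Rightarrow> real \<Rightarrow> real \<Rightarrow> real^('n2 + 'l)^('n2 + 'l)" where
  "H0_mat A2 \<gamma> \<beta> = block_matrix (\<beta>\<^sup>2 *\<^sub>R (transpose A2 ** A2)) 0 0 ((1 / \<gamma>) *\<^sub>R mat 1)"

text \<open>
  The set \<open>T\<close> collects the admissible pairs \<open>(v', z')\<close> of reference points.  The terms \<open>\<Theta> k\<close> are
  constrained for \<open>k \<ge> 1\<close> only, because \<open>\<Theta>\<close> may refer to the parameters of the previous iteration;
  the value \<open>\<Theta> 0\<close> is irrelevant.
\<close>

definition CC3 ::
  "real \<Rightarrow> ((real^'v) \<times> (real^'z)) set \<Rightarrow> (nat \<Rightarrow> real) \<Rightarrow> (nat \<Rightarrow> real^'v^'v) \<Rightarrow> (nat \<Rightarrow> real^'v^'v) \<Rightarrow>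
   (nat \<Rightarrow> real^'v^'v) \<Rightarrow> real^'z^'z \<Rightarrow> (nat \<Rightarrow> real) \<Rightarrow>
   (nat \<Rightarrow> real^'v) \<Rightarrow> (nat \<Rightarrow> real^'v) \<Rightarrow> (nat \<Rightarrow> real^'z) \<Rightarrow> bool" where
  "CC3 \<sigma> T r H G H0 R \<Theta> v vt z \<longleftrightarrow>
     (\<forall>k. r k > 0) \<and> (\<forall>k. pos_semidef (H0 k)) \<and> (\<forall>k\<ge>1. \<Theta> k \<ge> 0) \<and>
     (\<forall>k\<ge>1. \<forall>(v', z')\<in>T.
        r k * (sqnorm (H k) (v (Suc k) - v') + \<sigma> * sqnorm R (z k - z')
               - sqnorm (H k) (v k - v') + sqnorm (G k) (v k - vt k))
        \<ge> sqnorm (H0 (Suc k)) (v (Suc k) - v') - sqnorm (H0 k) (v k - v')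
           + \<Theta> (Suc k) - \<Theta> k)"

end

theory Submission
  imports Defs
begin

text \<open>
  The proof rests on an exact formula for the excess of the left over the right side of (CC3).
  Write \<open>e = x\<^sub>2\<^sup>k\<^sup>+\<^sup>1 - x\<^sub>2'\<close>, \<open>d = A\<^sub>2 (x\<^sub>2\<^sup>k - x\<^sub>2\<^sup>k\<^sup>+\<^sup>1)\<close>, and let \<open>r\<^sub>0\<close>, \<open>r\<close> be the residuals \<open>A x - b\<close>
  of the iterates \<open>k\<close> and \<open>k + 1\<close>.  The multiplier parts of \<open>H\<close> and \<open>H\<^sub>0\<close> differ exactly by the
  factor \<open>\<beta>\<^sub>k\<close>, so all terms containing \<open>\<lambda>\<close> cancel, and the excess is the sum of
  \<open>(\<beta>\<^sub>k\<^sup>2 - \<beta>\<^sub>k\<^sub>+\<^sub>1\<^sup>2) |A\<^sub>2 e|\<^sup>2 + \<beta>\<^sub>k \<sigma> |e|\<^sup>2\<close>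
  and
  \<open>\<beta>\<^sub>k\<^sup>2 (|d|\<^sup>2 + 2 d \<bullet> r + (1 + \<gamma> - \<gamma>\<^sup>2) |r|\<^sup>2) + (1 - \<gamma>)\<^sup>2 \<beta>\<^sub>k\<^sub>-\<^sub>1\<^sup>2 |r\<^sub>0|\<^sup>2\<close>.

  The first summand is nonnegative by the growth restriction on the penalties, because
  \<open>|A\<^sub>2 e|\<^sup>2 \<le> \<sigma>\<^sub>m\<^sub>a\<^sub>x |e|\<^sup>2\<close> (\<open>gram_max_eigenvalue\<close>).
  In the second summand \<open>1 + \<gamma> - \<gamma>\<^sup>2 \<ge> 0\<close> is the golden ratio condition, and only the cross term
  \<open>d \<bullet> r\<close> may be negative.  To bound it, observe that the optimality condition of an
  \<open>x\<^sub>2\<close>-subproblem (\<open>admm_subgradient\<close>) says that \<open>A\<^sub>2\<^sup>T (\<lambda>\<^sup>k - \<beta>\<^sub>k r)\<close> is a subgradient of \<open>f\<^sub>2\<close>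
  at \<open>x\<^sub>2\<^sup>k\<^sup>+\<^sup>1\<close>.  Subtracting the conditions of two consecutive steps and eliminating
  the multipliers by their update rule, monotonicity of the subdifferential becomes
  \<open>\<beta>\<^sub>k d \<bullet> r \<ge> (1 - \<gamma>) \<beta>\<^sub>k\<^sub>-\<^sub>1 d \<bullet> r\<^sub>0\<close> (\<open>admm_residual_monotone\<close>), which completes the square
  \<open>|\<beta>\<^sub>k d + (1 - \<gamma>) \<beta>\<^sub>k\<^sub>-\<^sub>1 r\<^sub>0|\<^sup>2\<close>.
\<close>

section \<open>The largest eigenvalue of a Gram matrix\<close>

text \<open>
  The first-order condition behind both the eigenvector property and the subgradient
  condition: near \<open>t = 0\<close> the linear term dominates.
\<close>

lemma linear_coeff_nonneg:
  fixes a c :: real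
  assumes "\<And>t. 0 < t \<Longrightarrow> t \<le> 1 \<Longrightarrow> 0 \<le> t * a + t\<^sup>2 * c"
  shows "0 \<le> a"
proof -
  have "0 \<le> a + t * c" if "0 < t" "t \<le> 1" for t
  proof -
    have "0 \<le> t * (a + t * c)"
      using assms[OF that] by (simp add: algebra_simps power2_eq_square)
    then show ?thesis
      using that(1) by (simp add: zero_le_mult_iff)
  qed
  then have "eventually (\<lambda>t. 0 \<le> a + t * c) (at_right 0)"
    by (intro eventually_at_rightI[of 0 1]) auto
  moreover have "((\<lambda>t. a + t * c) \<longlongrightarrow> a + 0 * c) (at_right 0)"
    by (intro tendsto_intros)
  ultimately show ?thesis
    using tendsto_lowerbound[of "\<lambda>t. a + t * c" "a + 0 * c" "at_right 0" 0] by simp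
qed

text \<open>
  A maximiser of the Rayleigh quotient over the unit sphere is an eigenvector: with \<open>c\<close> the
  maximum, \<open>c |y|\<^sup>2 - y \<bullet> M y\<close> is a nonnegative quadratic form vanishing at the maximiser \<open>u\<close>, so its
  first-order variation at \<open>u\<close> vanishes, in particular in the direction \<open>M u - c u\<close>.
\<close>

lemma symmetric_max_eigenvalue:
  fixes M :: "real^'n^'n"
  assumes sym: "transpose M = M"
  shows "y \<bullet> (M *v y) \<le> max_eigenvalue M * (norm y)\<^sup>2"
proof -
  have sph: "sphere (0::real^'n) 1 \<noteq> {}"
    by simp
  have "continuous_on (sphere 0 1) (\<lambda>y. y \<bullet> (M *v y))"
    by (intro continuous_intros matrix_vector_mult_linear_continuous_on)
  then obtain u where u: "u \<in> sphere 0 1"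
    and max: "\<And>y. y \<in> sphere 0 1 \<Longrightarrow> y \<bullet> (M *v y) \<le> u \<bullet> (M *v u)"
    using continuous_attains_sup[OF compact_sphere sph] by blast
  define c where "c = u \<bullet> (M *v u)"
  have u1: "u \<bullet> u = 1"
    using u by (simp add: norm_eq_1)
  have swap: "y \<bullet> (M *v z) = z \<bullet> (M *v y)" for y z
    by (metis sym dot_lmul_matrix inner_commute transpose_matrix_vector)
  have le: "y \<bullet> (M *v y) \<le> c * (y \<bullet> y)" for y
  proof (cases "y = 0")
    case False
    have "(inverse (norm y) *\<^sub>R y) \<bullet> (M *v (inverse (norm y) *\<^sub>R y)) \<le> c"
      unfolding c_def using False by (intro max) simp
    then have "(y \<bullet> (M *v y)) / (norm y)\<^sup>2 \<le> c"
      by (simp add: matrix_vector_mult_scaleR divide_simps power2_eq_square)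
    then show ?thesis
      using False by (simp add: divide_le_eq power2_norm_eq_inner)
  qed simp
  define z where "z = M *v u - c *\<^sub>R u"
  have "0 \<le> t * (- 2 * (z \<bullet> z)) + t\<^sup>2 * (c * (z \<bullet> z) - z \<bullet> (M *v z))" for t
  proof -
    have uz: "u \<bullet> z = 0"
      using u1 by (simp add: z_def inner_diff_right c_def[symmetric])
    then have zMu: "z \<bullet> (M *v u) = z \<bullet> z"
      by (simp add: z_def inner_diff_right inner_commute)
    have "(u + t *\<^sub>R z) \<bullet> (M *v (u + t *\<^sub>R z)) \<le> c * ((u + t *\<^sub>R z) \<bullet> (u + t *\<^sub>R z))"
      by (rule le)
    then show ?thesis
      using swap[of u z]
      by (simp add: matrix_vector_right_distrib matrix_vector_mult_scaleR inner_add_left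
          inner_add_right inner_commute[of z u] uz zMu u1 c_def[symmetric] power2_eq_square
          algebra_simps)
  qed
  then have "0 \<le> - 2 * (z \<bullet> z)"
    by (rule linear_coeff_nonneg)
  then have "z = 0"
    using inner_gt_zero_iff[of z] by linarith
  then have eig: "M *v u = c *\<^sub>R u"
    by (simp add: z_def)
  have "max_eigenvalue M = c"
    unfolding max_eigenvalue_def
  proof (rule Greatest_equality)
    show "\<exists>u. u \<noteq> 0 \<and> M *v u = c *\<^sub>R u"
      using eig u1 by (intro exI[of _ u]) auto
  next
    fix c' assume "\<exists>u. u \<noteq> 0 \<and> M *v u = c' *\<^sub>R u"
    then obtain w where "w \<noteq> 0" "M *v w = c' *\<^sub>R w"
      by blast
    then show "c' \<le> c"
      using le[of w] by simp
  qed
  then show ?thesis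
    using le by (simp add: power2_norm_eq_inner)
qed

lemma inner_gram:
  fixes A :: "real^'n^'l"
  shows "x \<bullet> ((transpose A ** A) *v y) = (A *v x) \<bullet> (A *v y)"
  by (metis dot_lmul_matrix inner_commute matrix_vector_mul_assoc transpose_matrix_vector
      transpose_transpose)

lemma gram_max_eigenvalue:
  fixes A :: "real^'n^'l"
  shows "(norm (A *v y))\<^sup>2 \<le> max_eigenvalue (transpose A ** A) * (norm y)\<^sup>2"
  using symmetric_max_eigenvalue[of "transpose A ** A" y]
  by (simp add: inner_gram matrix_transpose_mul power2_norm_eq_inner)

lemma gram_max_eigenvalue_pos:
  fixes A :: "real^'n^'l"
  assumes "A \<noteq> 0"
  shows "0 < max_eigenvalue (transpose A ** A)"
proof -
  obtain y where "A *v y \<noteq> 0"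
    using assms matrix_eq[of A 0] by auto
  then have "0 < max_eigenvalue (transpose A ** A) * (norm y)\<^sup>2"
    using gram_max_eigenvalue[of A y] by (smt (verit) zero_less_norm_iff zero_less_power)
  then show ?thesis
    by (simp add: zero_less_mult_iff)
qed

section \<open>Quadratic forms of block matrices\<close>

lemma sum_UNIV_sum_type:
  fixes f :: "'m::finite + 'l::finite \<Rightarrow> 'a::comm_monoid_add"
  shows "(\<Sum>i\<in>UNIV. f i) = (\<Sum>a\<in>UNIV. f (Inl a)) + (\<Sum>b\<in>UNIV. f (Inr b))"
  by (simp add: UNIV_Plus_UNIV[symmetric] sum.Plus del: UNIV_Plus_UNIV)

lemma stack_diff: "stack x y - stack x' y' = stack (x - x') (y - y')"
  by (simp add: stack_def vec_eq_iff split: sum.split)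

lemma sqnorm_block_stack:
  "sqnorm (block_matrix P Q S T) (stack x y)
     = x \<bullet> (P *v x) + x \<bullet> (Q *v y) + y \<bullet> (S *v x) + y \<bullet> (T *v y)"
  by (simp add: sqnorm_def block_matrix_def stack_def inner_vec_def matrix_vector_mult_def
      sum_UNIV_sum_type sum.distrib distrib_left)

lemma stack_exhaust: "\<exists>x y. w = stack x y"
  by (intro exI[of _ "\<chi> i. w $ Inl i"] exI[of _ "\<chi> i. w $ Inr i"])
    (simp add: stack_def vec_eq_iff split: sum.split)

lemma sqnorm_H_mat:
  "sqnorm (H_mat A \<gamma> \<beta>) (stack x y) = \<beta> * (norm (A *v x))\<^sup>2 + (norm y)\<^sup>2 / (\<gamma> * \<beta>)"
  by (simp add: H_mat_def sqnorm_block_stack scaleR_matrix_vector_assoc[symmetric] inner_gram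
      power2_norm_eq_inner)

lemma sqnorm_H0_mat:
  "sqnorm (H0_mat A \<gamma> \<beta>) (stack x y) = \<beta>\<^sup>2 * (norm (A *v x))\<^sup>2 + (norm y)\<^sup>2 / \<gamma>"
  by (simp add: H0_mat_def sqnorm_block_stack scaleR_matrix_vector_assoc[symmetric] inner_gram
      power2_norm_eq_inner)

lemma sqnorm_G_mat:
  "sqnorm (G_mat A \<gamma> \<beta>) (stack x y) = (1 - \<gamma>) * \<beta> * (norm (A *v x))\<^sup>2
     - 2 * (1 - \<gamma>) * ((A *v x) \<bullet> y) + (2 - \<gamma>) / \<beta> * (norm y)\<^sup>2"
proof -
  have neg: "(- N) *v z = - (N *v z)" for N :: "real^'c^'d" and z
    by (simp add: vec_eq_iff matrix_vector_mult_def sum_negf)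
  have tr: "x \<bullet> (transpose A *v y) = (A *v x) \<bullet> y"
    by (metis dot_lmul_matrix inner_commute transpose_matrix_vector)
  show ?thesis
    unfolding G_mat_def sqnorm_block_stack neg scaleR_matrix_vector_assoc[symmetric]
      inner_minus_right inner_scaleR_right inner_gram tr matrix_vector_mul_lid
      inner_commute[of y "A *v x"] power2_norm_eq_inner
    by simp
qed

lemma pos_semidef_H0_mat:
  fixes A :: "real^'n^'l"
  assumes "0 < \<gamma>"
  shows "pos_semidef (H0_mat A \<gamma> \<beta>)"
  unfolding pos_semidef_def
proof (intro conjI allI)
  define M where "M = transpose A ** A"
  have "transpose M = M"
    by (simp add: M_def matrix_transpose_mul)
  then have M: "M $ i $ j = M $ j $ i" for i j
    by (simp add: transpose_def vec_eq_iff)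
  have "H0_mat A \<gamma> \<beta> $ i $ j = H0_mat A \<gamma> \<beta> $ j $ i" for i j
    unfolding H0_mat_def block_matrix_def M_def[symmetric]
    using M by (cases i; cases j) (auto simp: mat_def)
  then show "transpose (H0_mat A \<gamma> \<beta>) = H0_mat A \<gamma> \<beta>"
    by (simp add: transpose_def vec_eq_iff)
next
  fix w :: "real^('n + 'l)"
  obtain x y where "w = stack x y"
    using stack_exhaust by blast
  then show "0 \<le> w \<bullet> (H0_mat A \<gamma> \<beta> *v w)"
    using sqnorm_H0_mat[of A \<gamma> \<beta> x y] assms by (simp add: sqnorm_def)
qed

section \<open>Subgradients from the subproblems\<close>

text \<open>
  Convexity along the segment from \<open>w\<^sub>0\<close> turns minimality of \<open>f\<close> plus a quadratic into a
  first-order condition on \<open>f\<close> alone: the quadratic contributes only its derivative, the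
  second-order term vanishing in the limit.
\<close>

lemma subgradient_of_quadratic_min:
  fixes f :: "real^'n \<Rightarrow> real" and A :: "real^'n^'l"
  assumes cvx: "convex_on UNIV f"
    and min: "\<And>w. f w\<^sub>0 - \<mu> \<bullet> (A *v w\<^sub>0 + q) + \<beta> / 2 * (norm (A *v w\<^sub>0 + q))\<^sup>2
                \<le> f w - \<mu> \<bullet> (A *v w + q) + \<beta> / 2 * (norm (A *v w + q))\<^sup>2"
  shows "transpose A *v (\<mu> - \<beta> *\<^sub>R (A *v w\<^sub>0 + q)) \<in> subdifferential f w\<^sub>0"
  unfolding subdifferential_def
proof (intro CollectI allI)
  fix w
  define r where "r = A *v w\<^sub>0 + q"
  define h where "h = A *v (w - w\<^sub>0)"
  have "0 \<le> t * (f w - f w\<^sub>0 - (\<mu> - \<beta> *\<^sub>R r) \<bullet> h) + t\<^sup>2 * (\<beta> / 2 * (norm h)\<^sup>2)"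
    if t: "0 < t" "t \<le> 1" for t
  proof -
    let ?w = "w\<^sub>0 + t *\<^sub>R (w - w\<^sub>0)"
    have "f ((1 - t) *\<^sub>R w\<^sub>0 + t *\<^sub>R w) \<le> (1 - t) * f w\<^sub>0 + t * f w"
      using t by (intro convex_onD[OF cvx]) auto
    then have fw: "f ?w \<le> (1 - t) * f w\<^sub>0 + t * f w"
      by (simp add: algebra_simps)
    have Aw: "A *v ?w + q = r + t *\<^sub>R h"
      by (simp add: r_def h_def matrix_vector_right_distrib matrix_vector_mult_scaleR)
    have "f w\<^sub>0 - \<mu> \<bullet> r + \<beta> / 2 * (norm r)\<^sup>2
        \<le> f ?w - \<mu> \<bullet> (r + t *\<^sub>R h) + \<beta> / 2 * (norm (r + t *\<^sub>R h))\<^sup>2"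
      using min[of ?w] unfolding Aw r_def .
    moreover have "(norm (r + t *\<^sub>R h))\<^sup>2 = (norm r)\<^sup>2 + 2 * t * (r \<bullet> h) + t\<^sup>2 * (norm h)\<^sup>2"
      by (simp add: power2_norm_eq_inner inner_add_left inner_add_right inner_commute[of h r]
          power2_eq_square[of t] distrib_left)
    ultimately have "0 \<le> f ?w - f w\<^sub>0 - t * (\<mu> \<bullet> h)
        + \<beta> / 2 * (2 * t * (r \<bullet> h) + t\<^sup>2 * (norm h)\<^sup>2)"
      by (simp add: inner_add_right distrib_left)
    also have "\<dots> \<le> (1 - t) * f w\<^sub>0 + t * f w - f w\<^sub>0 - t * (\<mu> \<bullet> h)
        + \<beta> / 2 * (2 * t * (r \<bullet> h) + t\<^sup>2 * (norm h)\<^sup>2)"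
      using fw by simp
    also have "\<dots> = t * (f w - f w\<^sub>0 - (\<mu> - \<beta> *\<^sub>R r) \<bullet> h) + t\<^sup>2 * (\<beta> / 2 * (norm h)\<^sup>2)"
      by (simp add: inner_diff_left algebra_simps)
    finally show ?thesis .
  qed
  then have "0 \<le> f w - f w\<^sub>0 - (\<mu> - \<beta> *\<^sub>R r) \<bullet> h"
    by (rule linear_coeff_nonneg)
  then show "f w \<ge> f w\<^sub>0 + (transpose A *v (\<mu> - \<beta> *\<^sub>R (A *v w\<^sub>0 + q))) \<bullet> (w - w\<^sub>0)"
    by (simp add: r_def h_def transpose_matrix_vector dot_lmul_matrix)
qed

lemma admm_subgradient:
  assumes cvx: "convex_on UNIV f2"
    and admm: "admm_sequence f1 f2 A1 A2 b \<gamma> \<beta> x1 x2 lam"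
  shows "transpose A2 *v (lam k - \<beta> k *\<^sub>R (A1 *v x1 (Suc k) + A2 *v x2 (Suc k) - b))
    \<in> subdifferential f2 (x2 (Suc k))"
proof -
  let ?q = "A1 *v x1 (Suc k) - b"
  have "is_arg_min (\<lambda>w. aug_lagrangian f1 f2 A1 A2 b (\<beta> k) (x1 (Suc k)) w (lam k))
      (\<lambda>_. True) (x2 (Suc k))"
    using admm by (simp add: admm_sequence_def)
  moreover have "A1 *v x1 (Suc k) + A2 *v w - b = A2 *v w + ?q" for w
    by simp
  ultimately have "transpose A2 *v (lam k - \<beta> k *\<^sub>R (A2 *v x2 (Suc k) + ?q))
      \<in> subdifferential f2 (x2 (Suc k))"
    by (intro subgradient_of_quadratic_min[OF cvx])
      (auto simp: is_arg_min_linorder aug_lagrangian_def algebra_simps)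
  then show ?thesis
    by (simp add: algebra_simps)
qed

lemma subdifferential_monotone:
  assumes "g \<in> subdifferential f x" "h \<in> subdifferential f y"
  shows "0 \<le> (g - h) \<bullet> (x - y)"
proof -
  have "f y \<ge> f x + g \<bullet> (y - x)" "f x \<ge> f y + h \<bullet> (x - y)"
    using assms by (auto simp: subdifferential_def)
  then show ?thesis
    by (simp add: inner_diff_left inner_diff_right)
qed

text \<open>
  With \<open>p\<^sub>k = \<lambda>\<^sup>k - \<beta>\<^sub>k res\<^sub>k\<^sub>+\<^sub>1\<close>, so that \<open>A\<^sub>2\<^sup>T p\<^sub>k\<close> is a subgradient at \<open>x\<^sub>2\<^sup>k\<^sup>+\<^sup>1\<close>, the multiplier update
  gives \<open>p\<^sub>k - p\<^sub>k\<^sub>+\<^sub>1 = \<beta>\<^sub>k\<^sub>+\<^sub>1 res\<^sub>k\<^sub>+\<^sub>2 - (1 - \<gamma>) \<beta>\<^sub>k res\<^sub>k\<^sub>+\<^sub>1\<close>: the multipliers cancel, and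
  monotonicity of the subdifferential relates consecutive residuals.
\<close>

lemma admm_residual_monotone:
  assumes cvx: "convex_on UNIV f2"
    and admm: "admm_sequence f1 f2 A1 A2 b \<gamma> \<beta> x1 x2 lam"
  defines "res \<equiv> \<lambda>k. A1 *v x1 k + A2 *v x2 k - b"
    and "d \<equiv> \<lambda>k. A2 *v (x2 k - x2 (Suc k))"
  shows "(1 - \<gamma>) * \<beta> k * (d (Suc k) \<bullet> res (Suc k)) \<le> \<beta> (Suc k) * (d (Suc k) \<bullet> res (Suc (Suc k)))"
proof -
  define p where "p = (\<lambda>k. lam k - \<beta> k *\<^sub>R res (Suc k))"
  have "lam (Suc k) = lam k - (\<gamma> * \<beta> k) *\<^sub>R res (Suc k)"
    using admm by (simp add: admm_sequence_def res_def)
  then have p: "p k - p (Suc k) = \<beta> (Suc k) *\<^sub>R res (Suc (Suc k)) - ((1 - \<gamma>) * \<beta> k) *\<^sub>R res (Suc k)"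
    by (simp add: p_def algebra_simps)
  have "0 \<le> (transpose A2 *v p k - transpose A2 *v p (Suc k)) \<bullet> (x2 (Suc k) - x2 (Suc (Suc k)))"
    unfolding p_def res_def by (intro subdifferential_monotone[where f = f2] admm_subgradient[OF cvx admm])
  also have "\<dots> = (p k - p (Suc k)) \<bullet> d (Suc k)"
    by (simp add: d_def transpose_matrix_vector dot_lmul_matrix inner_diff_left)
  finally show ?thesis
    unfolding p by (simp add: inner_diff_left inner_diff_right inner_commute[of _ "d (Suc k)"])
qed

section \<open>The inequality of a single step\<close>

lemma golden_ratio_quadratic:
  fixes \<gamma> :: real
  assumes "0 < \<gamma>" "\<gamma> \<le> (1 + sqrt 5) / 2"
  shows "0 \<le> 1 + \<gamma> - \<gamma>\<^sup>2"
proof -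
  have sqrt5: "1 \<le> sqrt 5"
    by simp
  have "0 \<le> (sqrt 5 - (2 * \<gamma> - 1)) * (sqrt 5 + (2 * \<gamma> - 1))"
  proof (rule mult_nonneg_nonneg)
    show "0 \<le> sqrt 5 - (2 * \<gamma> - 1)"
      using assms(2) by (simp add: field_simps)
    show "0 \<le> sqrt 5 + (2 * \<gamma> - 1)"
      using assms(1) sqrt5 by linarith
  qed
  also have "\<dots> = (sqrt 5)\<^sup>2 - (2 * \<gamma> - 1)\<^sup>2"
    by (simp add: algebra_simps power2_eq_square)
  also have "\<dots> = 4 * (1 + \<gamma> - \<gamma>\<^sup>2)"
    by (simp add: algebra_simps power2_eq_square)
  finally show ?thesis
    by simp
qed

lemma residual_terms_nonneg:
  fixes d r r\<^sub>0 :: "'a::real_inner"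
  assumes "0 < \<beta>" "0 \<le> 1 + \<gamma> - \<gamma>\<^sup>2"
    and cross: "(1 - \<gamma>) * \<beta>\<^sub>0 * (d \<bullet> r\<^sub>0) \<le> \<beta> * (d \<bullet> r)"
  shows "0 \<le> \<beta>\<^sup>2 * ((norm d)\<^sup>2 + 2 * (d \<bullet> r) + (1 + \<gamma> - \<gamma>\<^sup>2) * (norm r)\<^sup>2)
           + (1 - \<gamma>)\<^sup>2 * \<beta>\<^sub>0\<^sup>2 * (norm r\<^sub>0)\<^sup>2"
proof -
  have "0 \<le> (norm (\<beta> *\<^sub>R d + ((1 - \<gamma>) * \<beta>\<^sub>0) *\<^sub>R r\<^sub>0))\<^sup>2"
    by simp
  also have "\<dots> = \<beta>\<^sup>2 * (norm d)\<^sup>2 + 2 * (\<beta> * ((1 - \<gamma>) * \<beta>\<^sub>0 * (d \<bullet> r\<^sub>0)))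
      + (1 - \<gamma>)\<^sup>2 * \<beta>\<^sub>0\<^sup>2 * (norm r\<^sub>0)\<^sup>2"
    by (simp add: power2_norm_eq_inner inner_add_left inner_add_right inner_commute[of r\<^sub>0 d])
      (simp add: algebra_simps power2_eq_square)
  also have "\<dots> \<le> \<beta>\<^sup>2 * (norm d)\<^sup>2 + 2 * (\<beta> * (\<beta> * (d \<bullet> r))) + (1 - \<gamma>)\<^sup>2 * \<beta>\<^sub>0\<^sup>2 * (norm r\<^sub>0)\<^sup>2"
    using mult_left_mono[OF cross, of \<beta>] assms(1) by simp
  also have "\<dots> \<le> \<dots> + \<beta>\<^sup>2 * ((1 + \<gamma> - \<gamma>\<^sup>2) * (norm r)\<^sup>2)"
    using assms(2) by simp
  finally show ?thesis
    by (simp add: algebra_simps power2_eq_square)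
qed

lemma error_terms_nonneg:
  fixes A :: "real^'n^'l"
  assumes "A \<noteq> 0" "0 \<le> \<sigma>" "0 < \<beta>"
    and grow: "\<beta>\<^sub>1\<^sup>2 \<le> \<beta> * (\<beta> + \<sigma> / max_eigenvalue (transpose A ** A))"
  shows "0 \<le> (\<beta>\<^sup>2 - \<beta>\<^sub>1\<^sup>2) * (norm (A *v e))\<^sup>2 + \<beta> * \<sigma> * (norm e)\<^sup>2"
proof -
  define m where "m = max_eigenvalue (transpose A ** A)"
  have m: "0 < m"
    unfolding m_def by (rule gram_max_eigenvalue_pos[OF assms(1)])
  have "(\<beta>\<^sub>1\<^sup>2 - \<beta>\<^sup>2) * (norm (A *v e))\<^sup>2 \<le> \<beta> * \<sigma> / m * (norm (A *v e))\<^sup>2"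
    using grow by (intro mult_right_mono) (simp_all add: m_def algebra_simps power2_eq_square)
  also have "\<dots> \<le> \<beta> * \<sigma> / m * (m * (norm e)\<^sup>2)"
    using gram_max_eigenvalue[of A e] m assms(2,3)
    by (intro mult_left_mono) (simp_all add: m_def)
  also have "\<dots> = \<beta> * \<sigma> * (norm e)\<^sup>2"
    using m by simp
  finally show ?thesis
    by (simp add: algebra_simps)
qed

text \<open>
  The left side of (CC3) in terms of the errors \<open>(y, s)\<close> before and \<open>(e, s')\<close> after a step and the
  residual \<open>r\<close> after it.  The argument of \<open>G\<close> is the difference between iterate and predictor: its
  multiplier part is \<open>\<beta>\<close> times the residual with the old \<open>x\<^sub>2\<close>, which is \<open>r + d\<close>.  On these vectors
  the form of \<open>G\<close>, scaled by \<open>\<beta>\<close>, collapses to the last line.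
\<close>

lemma scaled_step_identity:
  fixes A :: "real^'n^'l" and s s' r :: "real^'l" and y e :: "real^'n"
  assumes "0 < \<gamma>" "0 < \<beta>"
  defines "d \<equiv> A *v (y - e)"
  shows "\<beta> * (sqnorm (H_mat A \<gamma> \<beta>) (stack e s') + \<sigma> * (norm e)\<^sup>2
      - sqnorm (H_mat A \<gamma> \<beta>) (stack y s) + sqnorm (G_mat A \<gamma> \<beta>) (stack (y - e) (\<beta> *\<^sub>R (r + d))))
    = \<beta>\<^sup>2 * (norm (A *v e))\<^sup>2 + (norm s')\<^sup>2 / \<gamma> + \<beta> * \<sigma> * (norm e)\<^sup>2
      - sqnorm (H0_mat A \<gamma> \<beta>) (stack y s)
      + \<beta>\<^sup>2 * ((norm d)\<^sup>2 + 2 * (d \<bullet> r) + (2 - \<gamma>) * (norm r)\<^sup>2)"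
proof -
  have H: "\<beta> * sqnorm (H_mat A \<gamma> \<beta>) (stack x z) = \<beta>\<^sup>2 * (norm (A *v x))\<^sup>2 + (norm z)\<^sup>2 / \<gamma>" for x z
    using assms(1,2) by (simp add: sqnorm_H_mat field_simps power2_eq_square)
  have "sqnorm (G_mat A \<gamma> \<beta>) (stack (y - e) (\<beta> *\<^sub>R (r + d)))
      = (1 - \<gamma>) * \<beta> * (norm d)\<^sup>2 - 2 * (1 - \<gamma>) * \<beta> * (d \<bullet> r + (norm d)\<^sup>2)
        + (2 - \<gamma>) * \<beta> * ((norm r)\<^sup>2 + 2 * (d \<bullet> r) + (norm d)\<^sup>2)"
  proof -
    have "(norm (\<beta> *\<^sub>R (r + d)))\<^sup>2 = \<beta>\<^sup>2 * ((norm r)\<^sup>2 + 2 * (d \<bullet> r) + (norm d)\<^sup>2)"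
      by (simp add: power_mult_distrib power2_norm_eq_inner inner_add_left inner_add_right
          inner_commute[of r d])
    moreover have "d \<bullet> (\<beta> *\<^sub>R (r + d)) = \<beta> * (d \<bullet> r + (norm d)\<^sup>2)"
      by (simp add: inner_add_right power2_norm_eq_inner)
    ultimately show ?thesis
      unfolding sqnorm_G_mat d_def[symmetric] using assms(2) by (simp add: power2_eq_square)
  qed
  then have G: "\<beta> * sqnorm (G_mat A \<gamma> \<beta>) (stack (y - e) (\<beta> *\<^sub>R (r + d)))
      = \<beta>\<^sup>2 * ((norm d)\<^sup>2 + 2 * (d \<bullet> r) + (2 - \<gamma>) * (norm r)\<^sup>2)"
    by algebra
  have "\<beta> * (h' + \<sigma> * n - h + g) = \<beta> * h' + \<beta> * \<sigma> * n - \<beta> * h + \<beta> * g" for h h' n g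
    by (simp add: algebra_simps)
  then show ?thesis
    by (simp only: H G sqnorm_H0_mat)
qed

theorem theorem3p3:
  fixes f1 :: "real^'n1 \<Rightarrow> real" and f2 :: "real^'n2 \<Rightarrow> real"
    and A1 :: "real^'n1^'l" and A2 :: "real^'n2^'l" and b :: "real^'l"
    and \<sigma> \<gamma> :: real and \<beta> :: "nat \<Rightarrow> real"
    and x1 :: "nat \<Rightarrow> real^'n1" and x2 :: "nat \<Rightarrow> real^'n2" and lam :: "nat \<Rightarrow> real^'l"
  assumes f1: "closed_proper_convex f1"
    and f2: "closed_proper f2" "strongly_convex \<sigma> f2" "\<sigma> > 0"
    and A2: "A2 \<noteq> 0"
    and \<gamma>: "0 < \<gamma>" "\<gamma> \<le> (1 + sqrt 5) / 2"
    and \<beta>_pos: "\<And>k. \<beta> k > 0"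
    and \<beta>1: "\<And>k. \<beta> k * (\<beta> k + \<sigma> / max_eigenvalue (transpose A2 ** A2)) \<ge> (\<beta> (k + 1))\<^sup>2"
    and \<beta>2: "\<And>k. k \<ge> 1 \<Longrightarrow>
           (\<beta> k) ^ 3 * max_eigenvalue (transpose A2 ** A2)
             / (\<beta> k * max_eigenvalue (transpose A2 ** A2) + \<sigma>) \<le> (\<beta> (k - 1))\<^sup>2"
    and \<beta>3: "\<And>k. \<beta> (k + 1) \<ge> \<beta> k"
    and admm: "admm_sequence f1 f2 A1 A2 b \<gamma> \<beta> x1 x2 lam"
  shows "CC3 \<sigma> {(stack x2' \<mu>, x2') | x1' x2' \<mu>. A1 *v x1' + A2 *v x2' = b}
           \<beta>
           (\<lambda>k. H_mat A2 \<gamma> (\<beta> k)) (\<lambda>k. G_mat A2 \<gamma> (\<beta> k)) (\<lambda>k. H0_mat A2 \<gamma> (\<beta> k))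
           (mat 1)
           (\<lambda>k. (1 - \<gamma>)\<^sup>2 * (\<beta> (k - 1))\<^sup>2 * (norm (A1 *v x1 k + A2 *v x2 k - b))\<^sup>2)
           (\<lambda>k. stack (x2 k) (lam k))
           (\<lambda>k. stack (x2 (k + 1))
                  (lam k - \<beta> k *\<^sub>R (A1 *v x1 (k + 1) + A2 *v x2 k - b)))
           (\<lambda>k. x2 (k + 1))"
proof -
  let ?r = "\<lambda>k. A1 *v x1 k + A2 *v x2 k - b"
  have cvx: "convex_on UNIV f2"
    using f2(2) by (simp add: strongly_convex_def)
  have step: "sqnorm (H0_mat A2 \<gamma> (\<beta> (Suc k))) (stack (x2 (Suc k)) (lam (Suc k)) - stack x2' \<mu>)
        - sqnorm (H0_mat A2 \<gamma> (\<beta> k)) (stack (x2 k) (lam k) - stack x2' \<mu>)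
        + (1 - \<gamma>)\<^sup>2 * (\<beta> k)\<^sup>2 * (norm (?r (Suc k)))\<^sup>2
        - (1 - \<gamma>)\<^sup>2 * (\<beta> (k - 1))\<^sup>2 * (norm (?r k))\<^sup>2
      \<le> \<beta> k * (sqnorm (H_mat A2 \<gamma> (\<beta> k)) (stack (x2 (Suc k)) (lam (Suc k)) - stack x2' \<mu>)
        + \<sigma> * sqnorm (mat 1) (x2 (Suc k) - x2')
        - sqnorm (H_mat A2 \<gamma> (\<beta> k)) (stack (x2 k) (lam k) - stack x2' \<mu>)
        + sqnorm (G_mat A2 \<gamma> (\<beta> k)) (stack (x2 k) (lam k)
            - stack (x2 (Suc k)) (lam k - \<beta> k *\<^sub>R (A1 *v x1 (Suc k) + A2 *v x2 k - b))))"
    if k1: "1 \<le> k" for k x2' \<mu>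
  proof -
    \<comment> \<open>Monotonicity needs \<open>x2 k\<close> itself to be the solution of a subproblem, that of step \<open>k - 1\<close>.\<close>
    obtain j where k: "k = Suc j"
      using k1 by (cases k) auto
    define e where "e = x2 (Suc k) - x2'"
    define y where "y = x2 k - x2'"
    define d where "d = A2 *v (y - e)"
    have d: "d = A2 *v (x2 k - x2 (Suc k))"
      by (simp add: d_def y_def e_def)
    have G: "stack (x2 k) (lam k)
          - stack (x2 (Suc k)) (lam k - \<beta> k *\<^sub>R (A1 *v x1 (Suc k) + A2 *v x2 k - b))
        = stack (y - e) (\<beta> k *\<^sub>R (?r (Suc k) + d))"
      by (simp add: stack_diff d y_def e_def matrix_vector_mult_diff_distrib add_diff_eq)
    have "(1 - \<gamma>) * \<beta> (k - 1) * (d \<bullet> ?r k) \<le> \<beta> k * (d \<bullet> ?r (Suc k))"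
      using admm_residual_monotone[OF cvx admm, of j] by (simp add: d k)
    then have res: "0 \<le> (\<beta> k)\<^sup>2 * ((norm d)\<^sup>2 + 2 * (d \<bullet> ?r (Suc k))
          + (1 + \<gamma> - \<gamma>\<^sup>2) * (norm (?r (Suc k)))\<^sup>2)
        + (1 - \<gamma>)\<^sup>2 * (\<beta> (k - 1))\<^sup>2 * (norm (?r k))\<^sup>2"
      by (intro residual_terms_nonneg \<beta>_pos golden_ratio_quadratic \<gamma>)
    have err: "0 \<le> ((\<beta> k)\<^sup>2 - (\<beta> (Suc k))\<^sup>2) * (norm (A2 *v e))\<^sup>2 + \<beta> k * \<sigma> * (norm e)\<^sup>2"
      using \<beta>1[of k] f2(3) by (intro error_terms_nonneg[OF A2]) (simp_all add: \<beta>_pos)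
    have I: "sqnorm (mat 1) e = (norm e)\<^sup>2"
      by (simp add: sqnorm_def power2_norm_eq_inner)
    have excess: "(\<beta> k)\<^sup>2 * a\<^sup>2 + s + \<beta> k * \<sigma> * (norm e)\<^sup>2 - h
          + (\<beta> k)\<^sup>2 * ((norm d)\<^sup>2 + 2 * t + (2 - \<gamma>) * n\<^sup>2)
          - ((\<beta> (Suc k))\<^sup>2 * a\<^sup>2 + s - h + (1 - \<gamma>)\<^sup>2 * (\<beta> k)\<^sup>2 * n\<^sup>2 - \<theta>)
        = ((\<beta> k)\<^sup>2 - (\<beta> (Suc k))\<^sup>2) * a\<^sup>2 + \<beta> k * \<sigma> * (norm e)\<^sup>2
          + ((\<beta> k)\<^sup>2 * ((norm d)\<^sup>2 + 2 * t + (1 + \<gamma> - \<gamma>\<^sup>2) * n\<^sup>2) + \<theta>)"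
      for a s h t n \<theta> :: real
      by algebra
    show ?thesis
      unfolding G unfolding stack_diff e_def[symmetric] y_def[symmetric] I
        scaled_step_identity[OF \<gamma>(1) \<beta>_pos[of k], where A = A2 and y = y and e = e,
          folded d_def]
      unfolding d_def[symmetric] sqnorm_H0_mat[of _ _ _ e]
      using excess[of "norm (A2 *v e)" "(norm (lam (Suc k) - \<mu>))\<^sup>2 / \<gamma>"
          "sqnorm (H0_mat A2 \<gamma> (\<beta> k)) (stack y (lam k - \<mu>))"
          "d \<bullet> ?r (Suc k)" "norm (?r (Suc k))"
          "(1 - \<gamma>)\<^sup>2 * (\<beta> (k - 1))\<^sup>2 * (norm (?r k))\<^sup>2"] res err by linarith
  qed
  show ?thesis
    unfolding CC3_def using step
    by (auto simp: \<beta>_pos pos_semidef_H0_mat[OF \<gamma>(1)])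
qed

end
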